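(* Let $f(\bm{x}):\mathbb{R}^N \rightarrow \mathbb{R}$ be a differentiable function, $\bm{e}$ be a random unit vector in $\mathbb{R}^N$ and $\Delta$ be a positive scalar. Define $$\bm{p} = \frac{f(\bm{x} + \Delta \cdot \bm{e}) - f(\bm{x})}{\Delta}\, \bm{e}.$$ Then $\nabla f(\bm{x})^{\top} \bm{p} > 0$ for a small enough $\Delta$ with probability 1 when $\nabla f(\bm{x}) \neq 0$.
   Context: $\nabla f(\bm{x})$ denotes the gradient of $f$ at the point $\bm{x}\in\mathbb{R}^N$, viewed as a column vector in $\mathbb{R}^N$, and $^{\top}$ denotes transpose. The probability is with respect to the random unit vector $\bm{e}$. *)

theory Defs
  imports "HOL-Probability.Probability"
begin

definition gradient :: "('a::real_inner \<Rightarrow> real) \<Rightarrow> 'a \<Rightarrow> 'a"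
  where "gradient f x = (THE D. GDERIV f x :> D)"

lemma gradient_eqI:
  fixes f :: "'a::real_inner \<Rightarrow> real"
  assumes "GDERIV f x :> D"
  shows "gradient f x = D"
  unfolding gradient_def
proof (rule the_equality)
  fix D' assume "GDERIV f x :> D'"
  then have "(\<lambda>h. inner h D') = (\<lambda>h. inner h D)"
    using assms unfolding gderiv_def by (rule has_derivative_unique)
  then have "inner (D' - D) (D' - D) = 0"
    by (metis inner_diff_right right_minus_eq)
  then show "D' = D" by simp
qed (fact assms)

lemma GDERIV_gradient:
  fixes f :: "'a::euclidean_space \<Rightarrow> real"
  assumes "f differentiable at x"
  shows "GDERIV f x :> gradient f x"
proof -
  obtain f' where f': "(f has_derivative f') (at x)"
    using assms unfolding differentiable_def by blast
  then have "f' = (\<lambda>h. inner h (adjoint f' 1))"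
    by (auto simp: adjoint_works[OF has_derivative_linear] inner_commute fun_eq_iff)
  then have "GDERIV f x :> adjoint f' 1"
    using f' unfolding gderiv_def by simp
  then show ?thesis using gradient_eqI by metis
qed

lemma gradient_nth:
  fixes f :: "real^'n \<Rightarrow> real"
  assumes "f differentiable at x"
  shows "((\<lambda>t. f (x + t *\<^sub>R axis i 1)) has_real_derivative gradient f x $ i) (at 0)"
proof -
  have "(f has_derivative (\<lambda>h. inner h (gradient f x))) (at (x + 0 *\<^sub>R axis i 1))"
    using GDERIV_gradient[OF assms] unfolding gderiv_def by simp
  moreover have "((\<lambda>t::real. x + t *\<^sub>R axis i 1) has_derivative (\<lambda>t. t *\<^sub>R axis i 1)) (at 0)"
    by (auto intro!: derivative_eq_intros)
  ultimately have "((\<lambda>t. f (x + t *\<^sub>R axis i 1)) has_derivative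
      (\<lambda>t. inner (t *\<^sub>R axis i 1) (gradient f x))) (at 0)"
    using has_derivative_compose by blast
  then show ?thesis
    by (simp add: has_field_derivative_def inner_axis' mult.commute[of _ "gradient f x $ i"] mult_commute_abs)
qed

text \<open>
  The uniform distribution on the unit sphere is the normalised surface (cone) measure, obtained by
  projecting the uniform distribution on the unit ball radially onto the sphere:
  \<^term>\<open>sgn v\<close> is \<^term>\<open>v /\<^sub>R norm v\<close> in a normed space.  The junk value
  \<^term>\<open>sgn 0 = 0\<close> only affects a null set.
\<close>

definition uniform_sphere :: "'a::euclidean_space measure"
  where "uniform_sphere = distr (uniform_measure lborel (ball 0 1)) borel sgn"

definition random_unit_vector :: "'w measure \<Rightarrow> ('w \<Rightarrow> 'a::euclidean_space) \<Rightarrow> bool"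
  where "random_unit_vector M e \<longleftrightarrow>
    e \<in> borel_measurable M \<and> (\<forall>\<omega>\<in>space M. norm (e \<omega>) = 1) \<and> distr M borel e = uniform_sphere"

definition finite_diff_vec :: "('a::real_normed_vector \<Rightarrow> real) \<Rightarrow> 'a \<Rightarrow> real \<Rightarrow> 'a \<Rightarrow> 'a"
  where "finite_diff_vec f x \<Delta> u = ((f (x + \<Delta> *\<^sub>R u) - f x) / \<Delta>) *\<^sub>R u"

lemma borel_measurable_sgn_euclidean [measurable]:
  "(sgn :: 'a::euclidean_space \<Rightarrow> 'a) \<in> borel_measurable borel"
  unfolding sgn_div_norm[abs_def] by measurable

lemma prob_space_uniform_ball:
  "prob_space (uniform_measure lborel (ball (0::'a::euclidean_space) 1))"
proof (rule prob_space_uniform_measure)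
  have "\<not> negligible (ball (0::'a) 1)"
    by (rule open_not_negligible) auto
  then show "emeasure lborel (ball (0::'a) 1) \<noteq> 0"
    by (auto simp: negligible_iff_null_sets null_sets_completion_iff null_sets_def)
  show "emeasure lborel (ball (0::'a) 1) \<noteq> \<infinity>"
    using emeasure_bounded_finite[OF bounded_ball, of "0::'a" 1] by simp
qed

lemma prob_space_uniform_sphere: "prob_space (uniform_sphere :: 'a::euclidean_space measure)"
  unfolding uniform_sphere_def by (intro prob_space.prob_space_distr prob_space_uniform_ball) simp

lemma AE_uniform_sphere: "AE u in (uniform_sphere :: 'a::euclidean_space measure). norm u = 1"
proof -
  have "AE v in lborel. v \<noteq> (0::'a)"
    by (rule AE_lborel_singleton)
  then have "AE v in uniform_measure lborel (ball (0::'a) 1). norm (sgn v) = 1"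
    by (intro AE_uniform_measureI) (auto simp: norm_sgn)
  then show ?thesis
    unfolding uniform_sphere_def by (subst AE_distr_iff) auto
qed

lemma uniform_sphere_rotation_invariant:
  fixes T :: "real^'n::{finite,wellorder} \<Rightarrow> real^'n::_"
  assumes T: "orthogonal_transformation T"
  shows "distr uniform_sphere borel T = uniform_sphere"
proof -
  let ?U = "uniform_measure lborel (ball (0::real^'n::{finite,wellorder}) 1)"
  have lin: "linear T" and bij: "bij T"
    using T by (auto simp: orthogonal_transformation_linear orthogonal_transformation_bij)
  have [measurable]: "T \<in> borel_measurable borel"
    using lin by (intro borel_measurable_continuous_onI linear_continuous_on) (simp add: linear_conv_bounded_linear)
  have meas: "emeasure lborel (T -` B) = emeasure lborel B" if B: "B \<in> sets borel" "bounded B" for B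
  proof -
    have eq: "T -` B = inv T ` B"
      using bij by (simp add: bij_vimage_eq_inv_image)
    have L: "B \<in> lmeasurable"
      using B by (intro bounded_set_imp_lmeasurable) auto
    have iT: "orthogonal_transformation (inv T)"
      using T by (rule orthogonal_transformation_inv)
    have "T -` B \<in> sets borel"
      using measurable_sets[OF \<open>T \<in> borel_measurable borel\<close> B(1)] by simp
    moreover have "emeasure lebesgue (inv T ` B) = emeasure lebesgue B"
      using measure_orthogonal_image[OF iT L] measurable_orthogonal_image[OF iT L] L
      by (simp add: emeasure_eq_measure2)
    ultimately show ?thesis
      using B by (simp add: eq)
  qed
  have U: "distr ?U borel T = ?U"
  proof (rule measure_eqI)
    fix A assume "A \<in> sets (distr ?U borel T)"
    then have A[measurable]: "A \<in> sets borel" by simp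
    have vA: "T -` A \<in> sets borel"
      using measurable_sets[OF \<open>T \<in> borel_measurable borel\<close> A] by simp
    have "ball 0 1 \<inter> T -` A = T -` (ball 0 1 \<inter> A)"
      using T by (auto simp: orthogonal_transformation_norm)
    then have "emeasure lborel (ball 0 1 \<inter> T -` A) = emeasure lborel (ball 0 1 \<inter> A)"
      using meas[of "ball 0 1 \<inter> A"] by (simp add: bounded_Int)
    then show "emeasure (distr ?U borel T) A = emeasure ?U A"
      using vA by (simp add: emeasure_distr)
  qed simp
  have "T (sgn v) = sgn (T v)" for v
    using T lin by (simp add: sgn_div_norm linear_cmul orthogonal_transformation_norm)
  then have "T \<circ> sgn = sgn \<circ> T" by auto
  then have "distr (distr ?U borel sgn) borel T = distr (distr ?U borel T) borel sgn"
    by (simp add: distr_distr)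
  then show ?thesis
    by (simp add: uniform_sphere_def U)
qed

end

theory Submission
  imports Defs
begin

text \<open>The inner product of the gradient with \<open>finite_diff_vec f x \<Delta> u\<close> is
  the difference quotient of \<open>f\<close> along \<open>u\<close> times
  \<open>gradient f x \<bullet> u\<close>. As \<Delta> decreases to 0 the quotient tends to the same
  number, so the product tends to its square
  (\<open>inner_gradient_finite_diff_vec_tendsto\<close>). The square is positive unless
  \<open>u\<close> is orthogonal to the gradient, and such directions have probability 0
  (\<open>AE_uniform_sphere_inner_neq_0\<close>).\<close>

lemma has_real_derivative_along_line:
  fixes f :: "'a::real_inner \<Rightarrow> real"
  assumes "GDERIV f x :> D"
  shows "((\<lambda>t. f (x + t *\<^sub>R u)) has_real_derivative D \<bullet> u) (at 0)"
proof -
  have "(f has_derivative (\<lambda>h. h \<bullet> D)) (at (x + 0 *\<^sub>R u))"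
    using assms unfolding gderiv_def by simp
  moreover have "((\<lambda>t::real. x + t *\<^sub>R u) has_derivative (\<lambda>t. t *\<^sub>R u)) (at 0)"
    by (auto intro!: derivative_eq_intros)
  ultimately have "((\<lambda>t. f (x + t *\<^sub>R u)) has_derivative (\<lambda>t. (t *\<^sub>R u) \<bullet> D)) (at 0)"
    using has_derivative_compose by blast
  then show ?thesis
    by (simp add: has_field_derivative_def inner_commute mult.commute[of _ "D \<bullet> u"] mult_commute_abs)
qed

lemma inner_gradient_finite_diff_vec_tendsto:
  fixes f :: "'a::euclidean_space \<Rightarrow> real"
  assumes "f differentiable at x"
  shows "((\<lambda>\<Delta>. gradient f x \<bullet> finite_diff_vec f x \<Delta> u) \<longlongrightarrow> (gradient f x \<bullet> u)\<^sup>2) (at_right 0)"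
proof -
  have "((\<lambda>\<Delta>. (f (x + \<Delta> *\<^sub>R u) - f x) / \<Delta>) \<longlongrightarrow> gradient f x \<bullet> u) (at 0)"
    using has_real_derivative_along_line[OF GDERIV_gradient[OF assms]]
    by (simp add: has_field_derivative_iff)
  then have "((\<lambda>\<Delta>. (f (x + \<Delta> *\<^sub>R u) - f x) / \<Delta>) \<longlongrightarrow> gradient f x \<bullet> u) (at_right 0)"
    by (rule tendsto_within_subset) simp
  from tendsto_mult_right[OF this, of "gradient f x \<bullet> u"] show ?thesis
    by (simp add: finite_diff_vec_def power2_eq_square)
qed

text \<open>The hyperplane orthogonal to \<open>a\<close> is Lebesgue null and invariant under
  positive scaling, so radial projection of the ball gives its trace on the sphere probability
  0.\<close>

lemma AE_uniform_sphere_inner_neq_0: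
  fixes a :: "'a::euclidean_space"
  assumes "a \<noteq> 0"
  shows "AE u in uniform_sphere. a \<bullet> u \<noteq> 0"
proof -
  have "{v. a \<bullet> v = 0} \<in> null_sets lborel"
    using negligible_hyperplane[of a 0] assms
    by (auto simp: negligible_iff_null_sets null_sets_completion_iff closed_hyperplane)
  then have "AE v in lborel. a \<bullet> v \<noteq> 0"
    using AE_not_in by fastforce
  \<comment> \<open>For \<open>v\<close> \<noteq> 0, \<open>sgn v\<close> is a positive multiple of
    \<open>v\<close>, so orthogonality to \<open>a\<close> is unaffected; \<open>v = 0\<close> is
    already excluded by \<open>a \<bullet> v \<noteq> 0\<close>.\<close>
  then have "AE v in uniform_measure lborel (ball 0 1). a \<bullet> sgn v \<noteq> 0"
    by (intro AE_uniform_measureI) (auto simp: sgn_div_norm)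
  then show ?thesis
    unfolding uniform_sphere_def by (subst AE_distr_iff) auto
qed

theorem theorem1:
  fixes f :: "real^'n \<Rightarrow> real"
    and x :: "real^'n"
    and M :: "'w measure"
    and e :: "'w \<Rightarrow> real^'n"
  assumes "\<And>y. f differentiable at y"
    and "prob_space M"
    and "random_unit_vector M e"
    and "gradient f x \<noteq> 0"
  shows "AE \<omega> in M. \<exists>\<Delta>\<^sub>0>0. \<forall>\<Delta>. 0 < \<Delta> \<and> \<Delta> < \<Delta>\<^sub>0 \<longrightarrow>
           gradient f x \<bullet> finite_diff_vec f x \<Delta> (e \<omega>) > 0"
proof -
  have [measurable]: "e \<in> borel_measurable M" and distr: "distr M borel e = uniform_sphere"
    using assms(3) by (auto simp: random_unit_vector_def)
  have "AE u in distr M borel e. gradient f x \<bullet> u \<noteq> 0"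
    unfolding distr by (rule AE_uniform_sphere_inner_neq_0[OF assms(4)])
  then have "AE \<omega> in M. gradient f x \<bullet> e \<omega> \<noteq> 0"
    by (subst (asm) AE_distr_iff) auto
  then show ?thesis
  proof eventually_elim
    case (elim \<omega>)
    \<comment> \<open>The limit is the square of a nonzero real, hence positive, and the expression
      inherits this sign near 0. The resulting threshold depends on \<omega>.\<close>
    then have "\<forall>\<^sub>F \<Delta> in at_right 0. gradient f x \<bullet> finite_diff_vec f x \<Delta> (e \<omega>) > 0"
      by (intro order_tendstoD(1)[OF inner_gradient_finite_diff_vec_tendsto[OF assms(1)]]) simp
    then show ?case
      by (auto simp: eventually_at_right_field)
  qed
qed

end
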